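(* Let $k\ge 1$ and let $G$ be a $k$-tree with $n$ vertices. If $G$ is chromatic dominated, then $\dfrac{n}{k+1}\le \Delta(G)$, where $\Delta(G)$ is the maximum degree of $G$.
   Context: A set $S$ of vertices of a graph $G$ is dominated by a vertex $v$ if every vertex of $S$ is adjacent to $v$. A dominated coloring of $G$ is a proper vertex coloring in which each (nonempty) color class is dominated by some vertex of $G$; $\chi_{dom}(G)$ is the minimum number of colors in a dominated coloring of $G$. $G$ is chromatic dominated if $\chi(G)=\chi_{dom}(G)$, where $\chi(G)$ is the chromatic number (a graph with no dominated coloring, such as a single vertex, is not chromatic dominated). A $k$-tree is a graph that can be reduced to the complete graph on $k$ vertices by a sequence of removals of a degree-$k$ vertex whose neighbors are pairwise adjacent. *)

theory Defs
  imports "HOL.Real" "Graph_Theory.Graph_Theory"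
begin

text \<open>
  Finite simple graphs are those of \<^locale>\<open>graph\<close>: finite, loop-free, symmetric digraphs without
  multiple arcs. Every edge is thus represented by two opposite arcs, so the degree of a vertex
  is its \<^const>\<open>out_degree\<close>, and \<open>u \<rightarrow>\<^bsub>G\<^esub> v\<close> expresses adjacency. Colors are natural numbers, and
  the number of colors of a coloring counts the colors that occur on some vertex.
\<close>

definition proper_coloring :: "('a, 'b) pre_digraph \<Rightarrow> ('a \<Rightarrow> nat) \<Rightarrow> bool" where
  "proper_coloring G c \<longleftrightarrow> (\<forall>u v. u \<rightarrow>\<^bsub>G\<^esub> v \<longrightarrow> c u \<noteq> c v)"

definition num_colors :: "('a, 'b) pre_digraph \<Rightarrow> ('a \<Rightarrow> nat) \<Rightarrow> nat" where
  "num_colors G c = card (c ` verts G)"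

definition dominated_by :: "('a, 'b) pre_digraph \<Rightarrow> 'a set \<Rightarrow> 'a \<Rightarrow> bool" where
  "dominated_by G S v \<longleftrightarrow> (\<forall>u\<in>S. u \<rightarrow>\<^bsub>G\<^esub> v)"

definition color_class :: "('a, 'b) pre_digraph \<Rightarrow> ('a \<Rightarrow> nat) \<Rightarrow> nat \<Rightarrow> 'a set" where
  "color_class G c i = {u \<in> verts G. c u = i}"

definition dominated_coloring :: "('a, 'b) pre_digraph \<Rightarrow> ('a \<Rightarrow> nat) \<Rightarrow> bool" where
  "dominated_coloring G c \<longleftrightarrow> proper_coloring G c \<and>
     (\<forall>i \<in> c ` verts G. \<exists>v \<in> verts G. dominated_by G (color_class G c i) v)"

definition chromatic_number :: "('a, 'b) pre_digraph \<Rightarrow> nat" where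
  "chromatic_number G = (LEAST m. \<exists>c. proper_coloring G c \<and> num_colors G c = m)"

text \<open>Only meaningful if \<open>G\<close> has a dominated coloring, i.e. has no isolated vertices.\<close>

definition dom_chromatic_number :: "('a, 'b) pre_digraph \<Rightarrow> nat" where
  "dom_chromatic_number G = (LEAST m. \<exists>c. dominated_coloring G c \<and> num_colors G c = m)"

definition chromatic_dominated :: "('a, 'b) pre_digraph \<Rightarrow> bool" where
  "chromatic_dominated G \<longleftrightarrow>
     (\<exists>c. dominated_coloring G c) \<and> chromatic_number G = dom_chromatic_number G"

inductive k_tree :: "nat \<Rightarrow> ('a, 'b) pre_digraph \<Rightarrow> bool" for k :: nat where
  complete: "complete_digraph k G \<Longrightarrow> k_tree k G"
| remove: "graph G \<Longrightarrow> v \<in> verts G \<Longrightarrow> out_degree G v = k \<Longrightarrow>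
     (\<And>u w. v \<rightarrow>\<^bsub>G\<^esub> u \<Longrightarrow> v \<rightarrow>\<^bsub>G\<^esub> w \<Longrightarrow> u \<noteq> w \<Longrightarrow> u \<rightarrow>\<^bsub>G\<^esub> w) \<Longrightarrow>
     k_tree k (pre_digraph.del_vert G v) \<Longrightarrow> k_tree k G"

lemma k_tree_imp_graph: "k_tree k G \<Longrightarrow> graph G"
  by (induction rule: k_tree.induct) (auto simp: complete_digraph_def)

definition max_degree :: "('a, 'b) pre_digraph \<Rightarrow> nat" where
  "max_degree G = Max (out_degree G ` verts G)"

end

theory Submission
  imports Defs
begin

text \<open>
  A \<open>k\<close>-tree has a proper coloring with at most \<open>k + 1\<close> colors: when a vertex is put back, its
  \<open>k\<close> neighbors block at most \<open>k\<close> of the \<open>k + 1\<close> colors. A chromatic dominated \<open>k\<close>-tree therefore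
  has a dominated coloring with at most \<open>k + 1\<close> classes. Each of these classes lies in the
  neighborhood of a single vertex and so has at most as many elements as the maximum degree;
  summing over the classes bounds the number of vertices.
\<close>

lemma finite_neighborhood:
  assumes "graph G"
  shows "finite {u. v \<rightarrow>\<^bsub>G\<^esub> u}"
proof -
  interpret graph G by fact
  show ?thesis
    by (rule finite_subset[OF _ finite_verts]) (auto dest: adj_in_verts)
qed

lemma card_neighborhood_le_out_degree:
  assumes "graph G"
  shows "card {u. v \<rightarrow>\<^bsub>G\<^esub> u} \<le> out_degree G v"
proof -
  interpret graph G by fact
  have sub: "{u. v \<rightarrow>\<^bsub>G\<^esub> u} \<subseteq> head G ` out_arcs G v"
    by (auto simp: arcs_ends_def arc_to_ends_def)
  have fin: "finite (out_arcs G v)"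
    by (rule finite_subset[OF _ finite_arcs]) (auto simp: out_arcs_def)
  have "card {u. v \<rightarrow>\<^bsub>G\<^esub> u} \<le> card (head G ` out_arcs G v)"
    using sub fin by (intro card_mono) auto
  also have "\<dots> \<le> out_degree G v"
    unfolding out_degree_def using fin by (rule card_image_le)
  finally show ?thesis .
qed

text \<open>
  Greedy step: \<open>v\<close> gets a color in \<open>{..k}\<close> that none of its at most \<open>k\<close> neighbors has, and
  edges away from \<open>v\<close> keep their colors.
\<close>

lemma extend_proper_coloring:
  assumes "graph G" and deg: "out_degree G v \<le> k"
    and proper: "proper_coloring (pre_digraph.del_vert G v) c"
    and colors: "c ` verts (pre_digraph.del_vert G v) \<subseteq> {..k}"
  shows "\<exists>c'. proper_coloring G c' \<and> c' ` verts G \<subseteq> {..k}"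
proof -
  interpret graph G by fact
  let ?N = "{u. v \<rightarrow>\<^bsub>G\<^esub> u}"
  have "card (c ` ?N) \<le> card ?N"
    by (rule card_image_le[OF finite_neighborhood[OF assms(1)]])
  also have "\<dots> \<le> k"
    using card_neighborhood_le_out_degree[OF assms(1)] deg by (rule order_trans)
  finally have "card (c ` ?N) < card {..k}" by simp
  then have "\<not> {..k} \<subseteq> c ` ?N"
    using card_mono[of "c ` ?N" "{..k}"] finite_neighborhood[OF assms(1)] by fastforce
  then obtain i where i: "i \<le> k" "i \<notin> c ` ?N" by auto
  have "proper_coloring G (c(v := i))"
    unfolding proper_coloring_def
  proof (intro allI impI)
    fix a b assume ab: "a \<rightarrow>\<^bsub>G\<^esub> b"
    then have ne: "a \<noteq> b" using adj_not_same by blast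
    have ba: "b \<rightarrow>\<^bsub>G\<^esub> a" using ab by (rule graph_symmetric)
    show "(c(v := i)) a \<noteq> (c(v := i)) b"
    proof (cases "a = v \<or> b = v")
      case True
      then show ?thesis using ab ba i ne by auto
    next
      case False
      then have "a \<rightarrow>\<^bsub>del_vert v\<^esub> b"
        using ab by (fastforce simp: arcs_ends_def arc_to_ends_def del_vert_simps)
      then show ?thesis using proper False by (auto simp: proper_coloring_def)
    qed
  qed
  moreover have "(c(v := i)) ` verts G \<subseteq> {..k}"
    using colors i by (auto simp: verts_del_vert)
  ultimately show ?thesis by blast
qed

lemma k_tree_colorable:
  assumes "k_tree k G"
  shows "\<exists>c. proper_coloring G c \<and> c ` verts G \<subseteq> {..k}"
  using assms
proof induction
  case (complete G)
  then interpret graph G by (simp add: complete_digraph_def)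
  have card: "card (verts G) = k" using complete by (simp add: complete_digraph_def)
  obtain c where c: "bij_betw c (verts G) {0..<k}"
    using ex_bij_betw_finite_nat[OF finite_verts] card by auto
  have "proper_coloring G c"
    unfolding proper_coloring_def
    using c adj_in_verts adj_not_same by (metis bij_betw_imp_inj_on inj_onD)
  moreover have "c ` verts G \<subseteq> {..k}"
    using c by (auto simp: bij_betw_def)
  ultimately show ?case by blast
next
  case (remove G v)
  then show ?case using extend_proper_coloring[of G v k] by auto
qed

lemma chromatic_number_k_tree_le:
  assumes "k_tree k G"
  shows "chromatic_number G \<le> k + 1"
proof -
  obtain c where c: "proper_coloring G c" "c ` verts G \<subseteq> {..k}"
    using k_tree_colorable[OF assms] by blast
  have "chromatic_number G \<le> num_colors G c"
    unfolding chromatic_number_def by (rule Least_le) (use c in blast)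
  also have "\<dots> \<le> k + 1"
    unfolding num_colors_def using card_mono[OF _ c(2)] by simp
  finally show ?thesis .
qed

text \<open>
  Domination asks for edges into the dominating vertex while the degree counts edges out of it;
  by symmetry of the graph the dominated set is still part of that vertex's out-neighborhood.
\<close>

lemma card_dominated_le_max_degree:
  assumes "graph G" and v: "v \<in> verts G" and dom: "dominated_by G S v"
  shows "card S \<le> max_degree G"
proof -
  interpret graph G by fact
  have "S \<subseteq> {u. v \<rightarrow>\<^bsub>G\<^esub> u}"
    using dom graph_symmetric by (auto simp: dominated_by_def)
  then have "card S \<le> card {u. v \<rightarrow>\<^bsub>G\<^esub> u}"
    by (rule card_mono[OF finite_neighborhood[OF assms(1)]])
  also have "\<dots> \<le> out_degree G v"
    by (rule card_neighborhood_le_out_degree[OF assms(1)])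
  also have "\<dots> \<le> max_degree G"
    unfolding max_degree_def using v by (intro Max_ge) auto
  finally show ?thesis .
qed

lemma card_verts_le_num_colors_mult_max_degree:
  assumes "graph G" and "dominated_coloring G c"
  shows "card (verts G) \<le> num_colors G c * max_degree G"
proof -
  interpret graph G by fact
  have "verts G = (\<Union>i\<in>c ` verts G. color_class G c i)"
    by (auto simp: color_class_def)
  then have "card (verts G) \<le> (\<Sum>i\<in>c ` verts G. card (color_class G c i))"
    using card_UN_le[of "c ` verts G" "color_class G c"] by simp
  also have "\<dots> \<le> (\<Sum>i\<in>c ` verts G. max_degree G)"
    using assms(2) card_dominated_le_max_degree[OF assms(1)]
    by (intro sum_mono) (auto simp: dominated_coloring_def)
  finally show ?thesis by (simp add: num_colors_def)
qed

theorem theorem2p6: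
  fixes G :: "('a, 'b) pre_digraph" and k n :: nat
  assumes "k \<ge> 1"
    and "k_tree k G"
    and "card (verts G) = n"
    and "chromatic_dominated G"
  shows "real n / real (k + 1) \<le> real (max_degree G)"
proof -
  have "\<exists>m c. dominated_coloring G c \<and> num_colors G c = m"
    using assms(4) by (auto simp: chromatic_dominated_def)
  then obtain c where c: "dominated_coloring G c" "num_colors G c = dom_chromatic_number G"
    unfolding dom_chromatic_number_def
    using LeastI_ex[of "\<lambda>m. \<exists>c. dominated_coloring G c \<and> num_colors G c = m"] by blast
  have "num_colors G c \<le> k + 1"
    using c(2) assms(4) chromatic_number_k_tree_le[OF assms(2)]
    by (simp add: chromatic_dominated_def)
  then have "n \<le> (k + 1) * max_degree G"
    using card_verts_le_num_colors_mult_max_degree[OF k_tree_imp_graph[OF assms(2)] c(1)]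
    unfolding assms(3) by (meson mult_le_mono1 le_trans)
  then have "real n \<le> real (k + 1) * real (max_degree G)"
    by (metis of_nat_le_iff of_nat_mult)
  then show ?thesis by (simp add: divide_le_eq mult.commute)
qed

end
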